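(* Let $\hbar>0$, $q=e^{i\pi\hbar}$, let $\omega_1,\omega_2$ be real parameters, and let $X,Y,Z$ be self-adjoint operators with scalar commutators $[X,Y]=[Y,Z]=[Z,X]=2\pi i\hbar$. Define, with operators ordered by the order of matrix multiplication, the quantum monodromy matrices (of a sphere with four holes/orbifold points) $$M_1=X_XLX_ZF_{\omega_1}X_ZRX_X,\qquad M_2=X_XRX_YF_{\omega_2}X_YLX_X .$$ Then $M_i=\begin{pmatrix}qa_i+\omega_i&-b_i\\c_i&-q^{-1}a_i\end{pmatrix}$ with $$a_1=e^{-Z},\quad b_1=e^{X-Z}+e^{X+Z}+\omega_1e^X,\quad c_1=e^{-X-Z},$$ $$a_2=e^{Y},\quad b_2=e^{X+Y},\quad c_2=e^{-X-Y}+e^{-X+Y}+\omega_2e^{-X}.$$ The entries satisfy the deformed $U_q(\mathfrak{sl}_2)$ relations, $i=1,2$, $$qa_ib_i=q^{-1}b_ia_i,\quad q^{-1}a_ic_i=qc_ia_i,\quad b_ic_i=1+\omega_iqa_i+q^2a_i^2,\quad c_ib_i=1+\omega_iq^{-1}a_i+q^{-2}a_i^2,$$ the relations \begin{align*} & q^{-1}a_1a_2=qa_2a_1,\quad q^{-1}b_1b_2=qb_2b_1,\quad q^{-1}c_1c_2=qc_2c_1,\quad a_1b_2=b_2a_1,\quad c_1a_2=a_2c_1,\quad qc_1b_2=q^{-1}b_2c_1,\\ & b_1a_2+q^{-2}a_1b_2+\omega_1q^{-1}b_2=a_2b_1+q^2b_2a_1+\omega_1qb_2,\\ & a_1c_2+q^{-2}c_1a_2+\omega_2q^{-1}c_1=c_2a_1+q^2a_2c_1+\omega_2qc_1,\\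 & qb_1c_2-q^{-1}c_2b_1=(q^2-q^{-2})\left[qa_1a_2+q^{-1}a_2a_1+\omega_1a_2+\omega_2a_1\right]+(q-q^{-1})\omega_1\omega_2, \end{align*} and the additional condition $a_1a_2=q^2c_1b_2$. Moreover, the elements $$K_1=a_1c_2-q^2c_1a_2-q\omega_2c_1,\qquad K_2=a_2b_1-q^{-2}b_2a_1-q^{-1}\omega_1b_2$$ are central (commute with all $a_i,b_i,c_i$) and satisfy $K_1K_2=1$.
   Context: $X_Y=\begin{pmatrix}0&-e^{Y/2}\\ e^{-Y/2}&0\end{pmatrix}$ for an operator $Y$ (so $X_X$ is this matrix for the operator $X$), $R=\begin{pmatrix}1&1\\-1&0\end{pmatrix}$, $L=R^2=\begin{pmatrix}0&1\\-1&-1\end{pmatrix}$, $F_\omega=\begin{pmatrix}0&1\\-1&-\omega\end{pmatrix}$. Exponentials of linear combinations of $X,Y,Z$ multiply by $e^Ue^V=e^{\frac12[U,V]}e^{U+V}$. *)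

theory Defs
  imports "HOL-Analysis.Analysis"
begin

section \<open>Complex Hilbert spaces\<close>

class scaleC =
  fixes scaleC :: "complex \<Rightarrow> 'a \<Rightarrow> 'a"  (infixr "*\<^sub>C" 75)

text \<open>The inner product is conjugate-linear in its first argument.\<close>

class chilbert = banach + scaleC +
  fixes cinner :: "'a \<Rightarrow> 'a \<Rightarrow> complex"
  assumes scaleC_add_right: "c *\<^sub>C (x + y) = c *\<^sub>C x + c *\<^sub>C y"
    and scaleC_add_left: "(c + d) *\<^sub>C x = c *\<^sub>C x + d *\<^sub>C x"
    and scaleC_scaleC: "c *\<^sub>C d *\<^sub>C x = (c * d) *\<^sub>C x"
    and scaleR_scaleC: "r *\<^sub>R x = complex_of_real r *\<^sub>C x"
    and cinner_commute: "cinner x y = cnj (cinner y x)"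
    and cinner_add_right: "cinner x (y + z) = cinner x y + cinner x z"
    and cinner_scaleC_right: "cinner x (c *\<^sub>C y) = c * cinner x y"
    and norm_eq_sqrt_cinner: "norm x = sqrt (Re (cinner x x))"

definition csubspace :: "'h::chilbert set \<Rightarrow> bool" where
  "csubspace S \<longleftrightarrow> 0 \<in> S \<and> (\<forall>x\<in>S. \<forall>y\<in>S. x + y \<in> S) \<and> (\<forall>c. \<forall>x\<in>S. c *\<^sub>C x \<in> S)"


section \<open>Unbounded operators\<close>

text \<open>An operator is a domain together with a map whose values outside the domain are
  irrelevant. Sums and products carry their natural domains, so these operations do not form
  a ring; identities between operators are meant on a common domain, see \<open>agree_on\<close>.\<close>

datatype 'h operator = Operator (op_dom: "'h set") (op_app: "'h \<Rightarrow> 'h")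

instantiation operator :: (chilbert) "{zero, one, plus, minus, uminus, times, scaleC}"
begin

definition "0 = Operator UNIV (\<lambda>v. 0)"
definition "1 = Operator UNIV (\<lambda>v. v)"
definition "A + B = Operator (op_dom A \<inter> op_dom B) (\<lambda>v. op_app A v + op_app B v)"
definition "A - B = Operator (op_dom A \<inter> op_dom B) (\<lambda>v. op_app A v - op_app B v)"
definition "- A = Operator (op_dom A) (\<lambda>v. - op_app A v)"
definition "A * B = Operator {v \<in> op_dom B. op_app B v \<in> op_dom A} (\<lambda>v. op_app A (op_app B v))"
definition "c *\<^sub>C A = Operator (op_dom A) (\<lambda>v. c *\<^sub>C op_app A v)"

instance ..

end

instance operator :: (chilbert) power ..

definition agree_on :: "'h operator \<Rightarrow> 'h set \<Rightarrow> 'h operator \<Rightarrow> bool"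
    ("(_/ \<doteq>\<^bsub>_\<^esub> _)" [51, 0, 51] 50) where
  "A \<doteq>\<^bsub>D\<^esub> B \<longleftrightarrow> D \<subseteq> op_dom A \<and> D \<subseteq> op_dom B \<and> (\<forall>v\<in>D. op_app A v = op_app B v)"

definition leaves_invariant :: "'h operator \<Rightarrow> 'h set \<Rightarrow> bool" where
  "leaves_invariant A D \<longleftrightarrow> D \<subseteq> op_dom A \<and> (\<forall>v\<in>D. op_app A v \<in> D)"

definition densely_defined_linear :: "'h::chilbert operator \<Rightarrow> bool" where
  "densely_defined_linear A \<longleftrightarrow>
     csubspace (op_dom A) \<and> closure (op_dom A) = UNIV \<and>
     (\<forall>x\<in>op_dom A. \<forall>y\<in>op_dom A. op_app A (x + y) = op_app A x + op_app A y) \<and>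
     (\<forall>c. \<forall>x\<in>op_dom A. op_app A (c *\<^sub>C x) = c *\<^sub>C op_app A x)"

definition adjoint_graph :: "'h::chilbert operator \<Rightarrow> ('h \<times> 'h) set" where
  "adjoint_graph A = {(y, z). \<forall>x\<in>op_dom A. cinner (op_app A x) y = cinner x z}"

definition selfadjoint :: "'h::chilbert operator \<Rightarrow> bool" where
  "selfadjoint A \<longleftrightarrow>
     densely_defined_linear A \<and> adjoint_graph A = {(x, op_app A x) |x. x \<in> op_dom A}"

text \<open>The exponential is the power series on the entire vectors of \<open>A\<close>. For self-adjoint \<open>A\<close>
  these vectors form a core of the exponential given by the functional calculus, and the two
  agree there.\<close>

definition exp_op :: "'h::chilbert operator \<Rightarrow> 'h operator" where
  "exp_op A =
     Operator {v. (\<forall>n. v \<in> op_dom (A ^ n)) \<and>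
                  (\<forall>t::real. summable (\<lambda>n. t ^ n * norm (op_app (A ^ n) v) / fact n))}
       (\<lambda>v. \<Sum>n. op_app (A ^ n) v /\<^sub>R fact n)"

text \<open>Commutation relations of unbounded operators, and products of their exponentials, need a
  common invariant domain to make sense. In the Schroedinger representation one may take the span
  of the functions \<open>p(x) exp(c x - x^2/2)\<close> with \<open>p\<close> a polynomial and \<open>c\<close> complex.\<close>

definition common_exp_domain ::
    "'h::chilbert set \<Rightarrow> 'h operator \<Rightarrow> 'h operator \<Rightarrow> 'h operator \<Rightarrow> bool" where
  "common_exp_domain D X Y Z \<longleftrightarrow>
     csubspace D \<and> closure D = UNIV \<and>
     leaves_invariant X D \<and> leaves_invariant Y D \<and> leaves_invariant Z D \<and>
     (\<forall>x y z :: real. leaves_invariant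
        (exp_op (complex_of_real x *\<^sub>C X + complex_of_real y *\<^sub>C Y + complex_of_real z *\<^sub>C Z)) D)"


section \<open>Matrices of operators\<close>

text \<open>The library product of matrices needs a semiring of entries.\<close>

definition opmat_mult ::
    "('h::chilbert operator)^2^2 \<Rightarrow> 'h operator^2^2 \<Rightarrow> 'h operator^2^2"  (infixl "\<star>\<star>" 70) where
  "A \<star>\<star> B = (\<chi> i j. A $ i $ 1 * B $ 1 $ j + A $ i $ 2 * B $ 2 $ j)"

definition opmat_agree_on ::
    "('h operator)^2^2 \<Rightarrow> 'h set \<Rightarrow> 'h operator^2^2 \<Rightarrow> bool"
    ("(_/ \<doteq>\<doteq>\<^bsub>_\<^esub> _)" [51, 0, 51] 50) where
  "A \<doteq>\<doteq>\<^bsub>D\<^esub> B \<longleftrightarrow> (\<forall>i j. A $ i $ j \<doteq>\<^bsub>D\<^esub> B $ i $ j)"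

definition scalar_opmat :: "complex^2^2 \<Rightarrow> ('h::chilbert operator)^2^2" where
  "scalar_opmat A = (\<chi> i j. (A $ i $ j) *\<^sub>C 1)"

definition edge_mat :: "'h::chilbert operator \<Rightarrow> 'h operator^2^2" where
  "edge_mat Y =
     vector [vector [0, - exp_op ((1/2) *\<^sub>C Y)],
             vector [exp_op ((-1/2) *\<^sub>C Y), 0]]"

definition R_num :: "complex^2^2" where
  "R_num = vector [vector [1, 1], vector [-1, 0]]"

definition R_mat :: "('h::chilbert operator)^2^2" where
  "R_mat = scalar_opmat R_num"

definition L_mat :: "('h::chilbert operator)^2^2" where
  "L_mat = scalar_opmat (R_num ** R_num)"

definition F_mat :: "real \<Rightarrow> ('h::chilbert operator)^2^2" where
  "F_mat w = scalar_opmat (vector [vector [0, 1], vector [-1, - complex_of_real w]])"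

definition monodromy1 ::
    "real \<Rightarrow> 'h::chilbert operator \<Rightarrow> 'h operator \<Rightarrow> 'h operator \<Rightarrow> 'h operator^2^2" where
  "monodromy1 w X Y Z =
     edge_mat X \<star>\<star> L_mat \<star>\<star> edge_mat Z \<star>\<star> F_mat w \<star>\<star> edge_mat Z \<star>\<star> R_mat \<star>\<star> edge_mat X"

definition monodromy2 ::
    "real \<Rightarrow> 'h::chilbert operator \<Rightarrow> 'h operator \<Rightarrow> 'h operator \<Rightarrow> 'h operator^2^2" where
  "monodromy2 w X Y Z =
     edge_mat X \<star>\<star> R_mat \<star>\<star> edge_mat Y \<star>\<star> F_mat w \<star>\<star> edge_mat Y \<star>\<star> L_mat \<star>\<star> edge_mat X"

definition monodromy_form ::
    "complex \<Rightarrow> real \<Rightarrow> 'h::chilbert operator \<Rightarrow> 'h operator \<Rightarrow> 'h operator \<Rightarrow> 'h operator^2^2" where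
  "monodromy_form q w a b c =
     vector [vector [q *\<^sub>C a + complex_of_real w *\<^sub>C 1, - b],
             vector [c, - (inverse q *\<^sub>C a)]]"

definition deformed_sl2_relations ::
    "'h::chilbert set \<Rightarrow> complex \<Rightarrow> real \<Rightarrow> 'h operator \<Rightarrow> 'h operator \<Rightarrow> 'h operator \<Rightarrow> bool" where
  "deformed_sl2_relations D q w a b c \<longleftrightarrow>
     q *\<^sub>C (a * b) \<doteq>\<^bsub>D\<^esub> inverse q *\<^sub>C (b * a) \<and>
     inverse q *\<^sub>C (a * c) \<doteq>\<^bsub>D\<^esub> q *\<^sub>C (c * a) \<and>
     b * c \<doteq>\<^bsub>D\<^esub> 1 + (complex_of_real w * q) *\<^sub>C a + q^2 *\<^sub>C a^2 \<and>
     c * b \<doteq>\<^bsub>D\<^esub> 1 + (complex_of_real w * inverse q) *\<^sub>C a + (inverse q)^2 *\<^sub>C a^2"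

end

theory Submission
  imports Defs
begin

text \<open>The analytic content is the Weyl relation \<open>e\<^sup>U e\<^sup>V v = e\<^sup>c\<^sup>/\<^sup>2 e\<^sup>U\<^sup>+\<^sup>V v\<close> for \<open>v\<close> in the common domain
  \<open>D\<close> and \<open>[U, V] = c\<close>. Nothing is known about the growth of mixed words in \<open>U\<close> and \<open>V\<close> on \<open>v\<close>, so
  \<open>e\<^sup>U\<close> is moved to a test vector \<open>w \<in> D\<close>: \<open>\<langle>w, e\<^sup>U e\<^sup>V v\<rangle> = \<langle>e\<^sup>U w, e\<^sup>V v\<rangle>\<close> is an absolutely convergent
  double series of the terms \<open>\<langle>U\<^sup>i w, V\<^sup>j v\<rangle> / (i! j!)\<close>. Comparing power series coefficients in a scaling
  parameter turns it into \<open>e\<^sup>c\<^sup>/\<^sup>2 \<langle>w, e\<^sup>U\<^sup>+\<^sup>V v\<rangle>\<close>, and \<open>D\<close> is dense. With the Weyl relation all claims are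
  identities between linear combinations of the vectors \<open>exp (x X + y Y + z Z) v\<close>; in particular
  \<open>K\<^sub>1 = exp (- X - Y - Z)\<close> and \<open>K\<^sub>2 = exp (X + Y + Z)\<close> on \<open>D\<close>.\<close>

section \<open>Complex Hilbert spaces\<close>

lemma scaleC_zero_left [simp]: "0 *\<^sub>C (x::'h::chilbert) = 0"
  using scaleR_scaleC[of 0 x] by simp

lemma scaleC_one [simp]: "1 *\<^sub>C (x::'h::chilbert) = x"
  using scaleR_scaleC[of 1 x] by simp

lemma scaleC_minus_left: "(- c) *\<^sub>C (x::'h::chilbert) = - (c *\<^sub>C x)"
  using scaleC_add_left[of c "- c" x] by (simp add: eq_neg_iff_add_eq_0 add.commute)

lemma scaleC_zero_right [simp]: "c *\<^sub>C (0::'h::chilbert) = 0"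
  using scaleC_add_right[of c 0 "0::'h"] by simp

lemma scaleC_minus_right: "c *\<^sub>C (- x::'h::chilbert) = - (c *\<^sub>C x)"
  using scaleC_add_right[of c x "- x"] by (simp add: eq_neg_iff_add_eq_0 add.commute)

lemma scaleC_diff_left: "(c - d) *\<^sub>C (x::'h::chilbert) = c *\<^sub>C x - d *\<^sub>C x"
  using scaleC_add_left[of c "- d" x] by (simp add: scaleC_minus_left)

lemma scaleC_diff_right: "c *\<^sub>C (x - y::'h::chilbert) = c *\<^sub>C x - c *\<^sub>C y"
  using scaleC_add_right[of c x "- y"] by (simp add: scaleC_minus_right)

lemma cinner_add_left: "cinner (x + y) (z::'h::chilbert) = cinner x z + cinner y z"
  by (metis cinner_add_right cinner_commute complex_cnj_add)

lemma cinner_scaleC_left: "cinner (c *\<^sub>C x) (y::'h::chilbert) = cnj c * cinner x y"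
  by (metis cinner_scaleC_right cinner_commute complex_cnj_mult)

text \<open>Positivity is not among the class axioms. It follows from
  \<open>norm_eq_sqrt_cinner\<close>: \<open>sqrt\<close> of a negative real is negative in HOL, so
  a nonnegative norm forces a nonnegative real part.\<close>

lemma cinner_self: "cinner (x::'h::chilbert) x = complex_of_real ((norm x)\<^sup>2)"
proof -
  have "Re (cinner x x) \<ge> 0"
    using norm_ge_zero[of x] unfolding norm_eq_sqrt_cinner by simp
  moreover have "Im (cinner x x) = 0"
    using arg_cong[OF cinner_commute[of x x], of Im] by simp
  ultimately show ?thesis
    by (simp add: norm_eq_sqrt_cinner complex_eq_iff)
qed

lemma norm_scaleC: "norm (c *\<^sub>C x::'h::chilbert) = cmod c * norm x"
proof -
  have "complex_of_real ((norm (c *\<^sub>C x))\<^sup>2) = (c * cnj c) * complex_of_real ((norm x)\<^sup>2)"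
    unfolding cinner_self[symmetric] cinner_scaleC_left cinner_scaleC_right
    by (simp add: mult_ac)
  also have "\<dots> = complex_of_real ((cmod c * norm x)\<^sup>2)"
    by (simp only: complex_norm_square[symmetric] of_real_mult power_mult_distrib)
  finally have "complex_of_real ((norm (c *\<^sub>C x))\<^sup>2) = complex_of_real ((cmod c * norm x)\<^sup>2)" .
  then have "(norm (c *\<^sub>C x))\<^sup>2 = (cmod c * norm x)\<^sup>2"
    by (simp only: of_real_eq_iff)
  then show ?thesis
    by (simp add: power2_eq_iff_nonneg)
qed

text \<open>Cauchy-Schwarz: \<open>z\<close> is the part of \<open>y\<close> orthogonal to
  \<open>x\<close>, and Pythagoras for \<open>z + d x\<close> with \<open>d = c / n\<close>, which
  is \<open>y\<close> itself, bounds the component along \<open>x\<close>.\<close>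

lemma norm_cinner_le: "cmod (cinner x (y::'h::chilbert)) \<le> norm x * norm y"
proof (cases "x = 0")
  case True
  have "cinner 0 y = 0"
    using cinner_scaleC_left[of 0 0 y] by simp
  then show ?thesis
    using True by simp
next
  case False
  then have nx: "norm x > 0" by simp
  define c where "c = cinner x y"
  define n where "n = complex_of_real ((norm x)\<^sup>2)"
  define z where "z = y - (c / n) *\<^sub>C x"
  have n_cnj: "cnj n = n" by (simp add: n_def)
  have n0: "n \<noteq> 0" using False by (simp add: n_def)
  have xz: "cinner x z = 0"
    using cinner_add_right[of x z "(c / n) *\<^sub>C x"] n0
    by (simp add: z_def cinner_scaleC_right cinner_self c_def n_def del: of_real_power)
  have zx: "cinner z x = 0"
    using cinner_commute[of z x] xz by simp
  have "cinner (z + d *\<^sub>C x) (z + d *\<^sub>C x) = cinner z z + cnj d * d * n" for d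
    using xz zx by (simp add: cinner_add_left cinner_add_right cinner_scaleC_left
        cinner_scaleC_right cinner_self[of x] n_def)
  from this[of "c / n"] have "cinner y y = cinner z z + cnj (c / n) * (c / n) * n"
    by (simp add: z_def)
  also have "cnj (c / n) * (c / n) * n = (c * cnj c) / n"
    using n0 by (simp add: n_cnj)
  also have "\<dots> = complex_of_real ((cmod c)\<^sup>2 / (norm x)\<^sup>2)"
    by (simp only: n_def complex_norm_square[symmetric] of_real_divide)
  finally have "complex_of_real ((norm y)\<^sup>2)
      = complex_of_real ((norm z)\<^sup>2 + (cmod c)\<^sup>2 / (norm x)\<^sup>2)"
    by (simp add: cinner_self)
  then have "(norm y)\<^sup>2 = (norm z)\<^sup>2 + (cmod c)\<^sup>2 / (norm x)\<^sup>2"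
    by (simp only: of_real_eq_iff)
  then have "(cmod c)\<^sup>2 / (norm x)\<^sup>2 \<le> (norm y)\<^sup>2" by simp
  then have "(cmod c)\<^sup>2 \<le> (norm x * norm y)\<^sup>2"
    using nx by (simp add: field_simps power_mult_distrib)
  then show ?thesis
    unfolding c_def by (rule power2_le_imp_le) simp
qed

lemma bounded_bilinear_cinner: "bounded_bilinear (cinner :: 'h::chilbert \<Rightarrow> 'h \<Rightarrow> complex)"
proof
  show "\<exists>K. \<forall>a b. norm (cinner a (b::'h)) \<le> norm a * norm b * K"
    using norm_cinner_le by (auto intro!: exI[of _ 1])
qed (simp_all add: cinner_add_left cinner_add_right scaleR_scaleC cinner_scaleC_left
    cinner_scaleC_right scaleR_conv_of_real)

interpretation cinner: bounded_bilinear "cinner :: 'h::chilbert \<Rightarrow> 'h \<Rightarrow> complex"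
  by (rule bounded_bilinear_cinner)

lemma bounded_linear_scaleC: "bounded_linear (\<lambda>x::'h::chilbert. c *\<^sub>C x)"
proof
  show "\<exists>K. \<forall>x::'h. norm (c *\<^sub>C x) \<le> norm x * K"
    by (auto simp: norm_scaleC intro!: exI[of _ "cmod c"])
qed (simp_all add: scaleC_add_right scaleR_scaleC scaleC_scaleC mult.commute)

text \<open>Approximating \<open>x - y\<close> itself by test vectors exhibits its squared norm as a
  limit of zeros.\<close>

lemma eq_if_cinner_dense:
  fixes x y :: "'h::chilbert"
  assumes "closure D = UNIV" and "\<And>w. w \<in> D \<Longrightarrow> cinner w x = cinner w y"
  shows "x = y"
proof -
  obtain w where w: "\<And>n. w n \<in> D" "w \<longlonglongrightarrow> x - y"
    using assms(1) closure_sequential[of "x - y" D] by auto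
  have "(\<lambda>n. cinner (w n) (x - y)) \<longlonglongrightarrow> cinner (x - y) (x - y)"
    by (intro cinner.tendsto w(2) tendsto_const)
  moreover have "cinner (w n) (x - y) = 0" for n
    using assms(2)[OF w(1)] by (simp add: cinner.diff_right)
  ultimately have "cinner (x - y) (x - y) = 0"
    by (simp add: LIMSEQ_const_iff)
  then show ?thesis by (simp add: cinner_self)
qed

section \<open>Cauchy products\<close>

text \<open>Absolute convergence makes the family \<open>p (x i) (y j)\<close> summable over all
  pairs. Summing it by rows gives \<open>p a b\<close>, and summing it by antidiagonals gives the
  Cauchy product.\<close>

lemma bounded_bilinear_Cauchy_product_sums:
  fixes x :: "nat \<Rightarrow> 'a::banach" and y :: "nat \<Rightarrow> 'b::banach"
    and p :: "'a \<Rightarrow> 'b \<Rightarrow> 'c::banach"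
  assumes p: "bounded_bilinear p"
    and x: "summable (\<lambda>n. norm (x n))" "x sums a"
    and y: "summable (\<lambda>n. norm (y n))" "y sums b"
  shows "(\<lambda>k. \<Sum>i\<le>k. p (x i) (y (k - i))) sums p a b"
proof -
  interpret bounded_bilinear p by fact
  let ?f = "\<lambda>(i, j). p (x i) (y j)"
  obtain K where K: "\<And>a b. norm (p a b) \<le> norm a * norm b * K"
    using bounded by blast
  have sx: "(x has_sum a) UNIV" and sy: "(y has_sum b) UNIV"
    using x y by (auto intro: norm_summable_imp_has_sum)
  have nx: "(\<lambda>n. norm (x n)) summable_on UNIV" and ny: "(\<lambda>n. norm (y n)) summable_on UNIV"
    using x y by (simp_all add: summable_on_UNIV_nonneg_real_iff)
  have "(\<lambda>(i, j). norm (x i) * norm (y j)) summable_on UNIV \<times> UNIV"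
  proof (rule summable_on_SigmaI)
    show "((\<lambda>j. case (i, j) of (i, j) \<Rightarrow> norm (x i) * norm (y j))
        has_sum norm (x i) * (\<Sum>\<^sub>\<infinity>j. norm (y j))) UNIV" for i
      using has_sum_cmult_right[OF has_sum_infsum[OF ny], of "norm (x i)"] by simp
    show "(\<lambda>i. norm (x i) * (\<Sum>\<^sub>\<infinity>j. norm (y j))) summable_on UNIV"
      by (rule summable_on_cmult_left[OF nx])
  qed simp
  then have "(\<lambda>u. (case u of (i, j) \<Rightarrow> norm (x i) * norm (y j)) * K) summable_on UNIV \<times> UNIV"
    by (rule summable_on_cmult_left)
  then have "(\<lambda>u. norm (?f u)) summable_on UNIV \<times> UNIV"
    by (rule Infinite_Sum.abs_summable_on_comparison_test') (use K in auto)
  then have "?f summable_on UNIV \<times> UNIV"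
    by (rule abs_summable_summable)
  then obtain s where s: "(?f has_sum s) (UNIV \<times> UNIV)"
    by (auto simp: summable_on_def)
  have "((\<lambda>i. p (x i) b) has_sum s) UNIV"
    by (rule has_sum_SigmaD[OF s]) (use has_sum_bounded_linear[OF bounded_linear_right sy] in simp)
  moreover have "((\<lambda>i. p (x i) b) has_sum p a b) UNIV"
    by (rule has_sum_bounded_linear[OF bounded_linear_left sx])
  ultimately have "s = p a b"
    by (rule has_sum_unique)
  \<comment> \<open>The antidiagonal index \<open>(k, i)\<close> with \<open>i\<close> at most
    \<open>k\<close> stands for the pair \<open>(i, k - i)\<close>.\<close>
  have "((\<lambda>(k, i). p (x i) (y (k - i))) has_sum s) (SIGMA k:UNIV. {..k})
      = (?f has_sum s) (UNIV \<times> UNIV)"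
    by (rule has_sum_reindex_bij_witness[of _ "\<lambda>(i, j). (i + j, i)" "\<lambda>(k, i). (i, k - i)"]) auto
  with s have S: "((\<lambda>(k, i). p (x i) (y (k - i))) has_sum s) (SIGMA k:UNIV. {..k})"
    by blast
  have "((\<lambda>k. \<Sum>i\<le>k. p (x i) (y (k - i))) has_sum s) UNIV"
    by (rule has_sum_SigmaD[OF S]) (simp add: has_sum_finiteI)
  then show ?thesis
    unfolding \<open>s = p a b\<close> by (rule has_sum_imp_sums)
qed

section \<open>The Weyl relation\<close>

text \<open>The formal power series of exp (c t^2) in the variable t.\<close>

definition gauss_fps :: "complex \<Rightarrow> complex fps" where
  "gauss_fps c = Abs_fps (\<lambda>n. if even n then c ^ (n div 2) / fact (n div 2) else 0)"

text \<open>The differential equation f' = 2 c t f of exp (c t^2). It will absorb the commutator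
  term in the derivative of the pairing series.\<close>

lemma fps_deriv_gauss: "fps_deriv (gauss_fps c) = fps_const (2 * c) * (fps_X * gauss_fps c)"
proof (rule fps_ext)
  fix n
  show "fps_nth (fps_deriv (gauss_fps c)) n = fps_nth (fps_const (2 * c) * (fps_X * gauss_fps c)) n"
  proof (cases "even n")
    case True
    then show ?thesis by (simp add: gauss_fps_def)
  next
    case False
    then obtain m where m: "n = 2 * m + 1" by (elim oddE)
    have "(1 + complex_of_nat m) \<noteq> 0"
      by (metis of_nat_Suc of_nat_neq_0)
    then show ?thesis
      by (simp add: gauss_fps_def m divide_simps)
  qed
qed

lemma gauss_fps_sums:
  "(\<lambda>n. fps_nth (gauss_fps c) n) sums exp c" "summable (\<lambda>n. norm (fps_nth (gauss_fps c) n))"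
proof -
  have mono: "strict_mono (\<lambda>n::nat. 2 * n)"
    by (simp add: strict_mono_def)
  have zero: "fps_nth (gauss_fps c) n = 0" if "n \<notin> range (\<lambda>n. 2 * n)" for n
    using that by (auto simp: gauss_fps_def elim!: evenE)
  have "(\<lambda>n. fps_nth (gauss_fps c) (2 * n)) sums exp c"
    using exp_converges[of c] by (simp add: gauss_fps_def scaleR_conv_of_real field_simps)
  then show "(\<lambda>n. fps_nth (gauss_fps c) n) sums exp c"
    using sums_mono_reindex[OF mono, of "\<lambda>n. fps_nth (gauss_fps c) n"] zero by blast
  have "summable (\<lambda>n. norm (fps_nth (gauss_fps c) (2 * n)))"
    using summable_norm_exp[of c] by (simp add: gauss_fps_def scaleR_conv_of_real field_simps norm_divide norm_mult)
  then show "summable (\<lambda>n. norm (fps_nth (gauss_fps c) n))"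
    using summable_mono_reindex[OF mono, of "\<lambda>n. norm (fps_nth (gauss_fps c) n)"] zero by auto
qed

section \<open>Linear and symmetric maps on a subspace, with no condition on values
  elsewhere\<close>

definition clinear_on :: "'h::chilbert set \<Rightarrow> ('h \<Rightarrow> 'h) \<Rightarrow> bool" where
  "clinear_on D f \<longleftrightarrow> (\<forall>x\<in>D. \<forall>y\<in>D. f (x + y) = f x + f y) \<and> (\<forall>c. \<forall>x\<in>D. f (c *\<^sub>C x) = c *\<^sub>C f x)"

definition symmetric_on :: "'h::chilbert set \<Rightarrow> ('h \<Rightarrow> 'h) \<Rightarrow> bool" where
  "symmetric_on D f \<longleftrightarrow> (\<forall>x\<in>D. \<forall>y\<in>D. cinner (f x) y = cinner x (f y))"

lemma csubspaceD:
  assumes "csubspace D"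
  shows "0 \<in> D" "x \<in> D \<Longrightarrow> y \<in> D \<Longrightarrow> x + y \<in> D" "x \<in> D \<Longrightarrow> c *\<^sub>C x \<in> D"
    "x \<in> D \<Longrightarrow> - x \<in> D" "x \<in> D \<Longrightarrow> y \<in> D \<Longrightarrow> x - y \<in> D"
proof -
  show A: "0 \<in> D" "x \<in> D \<Longrightarrow> y \<in> D \<Longrightarrow> x + y \<in> D" "x \<in> D \<Longrightarrow> c *\<^sub>C x \<in> D" for x y c
    using assms by (auto simp: csubspace_def)
  show M: "- x \<in> D" if "x \<in> D" for x
    using A(3)[OF that, of "-1"] by (simp add: scaleC_minus_left)
  show "x - y \<in> D" if "x \<in> D" "y \<in> D"
    using A(2)[OF that(1) M[OF that(2)]] by simp
qed

lemma clinear_on_minus: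
  assumes "clinear_on D f" "x \<in> D"
  shows "f (- x) = - f x"
  using assms unfolding clinear_on_def by (metis scaleC_minus_left scaleC_one)

lemma clinear_on_diff:
  assumes "clinear_on D f" "csubspace D" "x \<in> D" "y \<in> D"
  shows "f (x - y) = f x - f y"
proof -
  have "f (x + - y) = f x + f (- y)"
    using assms csubspaceD(4)[OF assms(2)] unfolding clinear_on_def by blast
  then show ?thesis
    using assms by (simp add: clinear_on_minus)
qed

text \<open>The two maps enter differently: powers of \<open>U\<close> are moved to the test vector,
  which calls for symmetry, while powers of \<open>V\<close> act on sums and multiples of vectors,
  which calls for linearity.\<close>

locale canonical_pair =
  fixes D :: "'h::chilbert set" and U V :: "'h \<Rightarrow> 'h" and c :: complex
  assumes D: "csubspace D"
    and U_in: "\<And>x. x \<in> D \<Longrightarrow> U x \<in> D" and V_in: "\<And>x. x \<in> D \<Longrightarrow> V x \<in> D"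
    and V_linear: "clinear_on D V"
    and U_symmetric: "symmetric_on D U"
    and commutator: "\<And>x. x \<in> D \<Longrightarrow> U (V x) - V (U x) = c *\<^sub>C x"
begin

lemma U_pow_in: "x \<in> D \<Longrightarrow> (U ^^ n) x \<in> D"
  by (induction n) (auto intro: U_in)

lemma V_pow_in: "x \<in> D \<Longrightarrow> (V ^^ n) x \<in> D"
  by (induction n) (auto intro: V_in)

text \<open>Moving \<open>U\<close> through \<open>j\<close> factors \<open>V\<close> costs one
  commutator per factor. For \<open>j = 0\<close> the truncated exponent \<open>j - 1\<close> is
  harmless, because its coefficient vanishes.\<close>

lemma V_pow_U:
  assumes "x \<in> D"
  shows "(V ^^ j) (U x) = U ((V ^^ j) x) - (of_nat j * c) *\<^sub>C (V ^^ (j - 1)) x"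
proof (induction j)
  case 0
  then show ?case by simp
next
  case (Suc j)
  have *: "V ((of_nat j * c) *\<^sub>C (V ^^ (j - Suc 0)) x) = (of_nat j * c) *\<^sub>C (V ^^ j) x"
    using V_linear V_pow_in[OF assms] unfolding clinear_on_def
    by (cases j) (auto, metis assms scaleC_zero_left)
  have "(V ^^ Suc j) (U x) = V (U ((V ^^ j) x)) - (of_nat j * c) *\<^sub>C (V ^^ j) x"
    using Suc assms by (simp add: * clinear_on_diff[OF V_linear D] U_in V_pow_in csubspaceD[OF D])
  also have "V (U ((V ^^ j) x)) = U (V ((V ^^ j) x)) - c *\<^sub>C (V ^^ j) x"
    using commutator[OF V_pow_in[OF assms, of j]] by (simp add: algebra_simps)
  finally show ?case
    by (simp add: scaleC_add_left algebra_simps)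
qed

lemma V_pow_add: "x \<in> D \<Longrightarrow> y \<in> D \<Longrightarrow> (V ^^ j) (x + y) = (V ^^ j) x + (V ^^ j) y"
proof (induction j)
  case (Suc j)
  then show ?case using V_linear V_pow_in unfolding clinear_on_def by simp
qed simp

definition pairing :: "'h \<Rightarrow> 'h \<Rightarrow> nat \<Rightarrow> nat \<Rightarrow> complex" where
  "pairing w v i j = cinner ((U ^^ i) w) ((V ^^ j) v) / (fact i * fact j)"

text \<open>The expansion in a real parameter t of \<langle>exp (t U) w, exp (t V) v\<rangle>, taken
  formally.\<close>

definition pairing_fps :: "'h \<Rightarrow> 'h \<Rightarrow> complex fps" where
  "pairing_fps w v = Abs_fps (\<lambda>k. \<Sum>i\<le>k. pairing w v i (k - i))"

text \<open>Pulling \<open>U\<close> in front of the powers of \<open>V\<close> and then across the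
  inner product raises \<open>i\<close>, and \<open>V\<close> raises \<open>j\<close>. The successor
  factors repair the factorials, and the commutators lower \<open>j\<close>.\<close>

lemma pairing_shift:
  assumes "w \<in> D" "v \<in> D"
  shows "pairing w (U v + V v) i j = of_nat (Suc i) * pairing w v (Suc i) j
    + of_nat (Suc j) * pairing w v i (Suc j) - (if j = 0 then 0 else c * pairing w v i (j - 1))"
proof -
  have n: "1 + complex_of_nat m \<noteq> 0" for m
    by (metis of_nat_Suc of_nat_neq_0)
  have "cinner ((U ^^ i) w) (U ((V ^^ j) v)) = cinner ((U ^^ Suc i) w) ((V ^^ j) v)"
    using U_symmetric U_pow_in[OF assms(1)] V_pow_in[OF assms(2)]
    by (simp add: symmetric_on_def)
  then have "cinner ((U ^^ i) w) ((V ^^ j) (U v + V v)) = cinner ((U ^^ Suc i) w) ((V ^^ j) v)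
      + cinner ((U ^^ i) w) ((V ^^ Suc j) v)
      - of_nat j * c * cinner ((U ^^ i) w) ((V ^^ (j - 1)) v)"
    using assms by (simp add: V_pow_add U_in V_in V_pow_U cinner.add_right cinner.diff_right
        cinner_scaleC_right funpow_swap1)
  then show ?thesis
    using n[of i] n[of j] n[of "j - 1"]
    by (cases j) (simp_all add: pairing_def divide_simps del: funpow.simps)
qed

text \<open>The product rule in t: the two derivatives combine to \<open>U + V\<close> acting on
  \<open>v\<close>, except that commuting \<open>U\<close> past exp (t V) leaves the extra term c
  t.\<close>

lemma pairing_fps_deriv:
  assumes "w \<in> D" "v \<in> D"
  shows "fps_deriv (pairing_fps w v)
    = pairing_fps w (U v + V v) + fps_const c * (fps_X * pairing_fps w v)"
proof (rule fps_ext)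
  fix k
  let ?t = "pairing w v"
  have "fps_nth (fps_deriv (pairing_fps w v)) k = (\<Sum>i\<le>Suc k. of_nat (Suc k) * ?t i (Suc k - i))"
    by (simp add: pairing_fps_def sum_distrib_left del: sum.atMost_Suc)
  \<comment> \<open>The factor k + 1 splits as i + (k + 1 - i), one part for each of the two
    exponentials being differentiated.\<close>
  also have "\<dots> = (\<Sum>i\<le>Suc k. of_nat i * ?t i (Suc k - i))
      + (\<Sum>i\<le>Suc k. of_nat (Suc k - i) * ?t i (Suc k - i))"
    unfolding sum.distrib[symmetric]
    by (intro sum.cong refl) (simp add: of_nat_diff algebra_simps)
  also have "(\<Sum>i\<le>Suc k. of_nat i * ?t i (Suc k - i)) = (\<Sum>i\<le>k. of_nat (Suc i) * ?t (Suc i) (k - i))"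
    by (subst sum.atMost_Suc_shift) simp
  also have "(\<Sum>i\<le>Suc k. of_nat (Suc k - i) * ?t i (Suc k - i))
      = (\<Sum>i\<le>k. of_nat (Suc (k - i)) * ?t i (Suc (k - i)))"
    by (simp add: Suc_diff_le add_diff_eq)
  also have "(\<Sum>i\<le>k. of_nat (Suc i) * ?t (Suc i) (k - i)) + \<dots>
      = (\<Sum>i\<le>k. pairing w (U v + V v) i (k - i))
        + (\<Sum>i\<le>k. if k - i = 0 then 0 else c * ?t i (k - i - 1))"
    unfolding sum.distrib[symmetric]
    by (intro sum.cong refl) (simp only: pairing_shift[OF assms] algebra_simps)
  also have "(\<Sum>i\<le>k. if k - i = 0 then 0 else c * ?t i (k - i - 1))
      = fps_nth (fps_const c * (fps_X * pairing_fps w v)) k"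
    by (cases k) (auto simp: pairing_fps_def sum_distrib_left Suc_diff_le intro!: sum.cong)
  finally show "fps_nth (fps_deriv (pairing_fps w v)) k
      = fps_nth (pairing_fps w (U v + V v) + fps_const c * (fps_X * pairing_fps w v)) k"
    by (simp add: pairing_fps_def)
qed

text \<open>The coefficientwise form of \<open>\<langle>w, exp (t (U + V)) v\<rangle> = exp (- c t\<^sup>2 / 2) \<langle>exp (t U) w, exp (t V) v\<rangle>\<close>:
  by \<open>pairing_fps_deriv\<close>, differentiating the right-hand side in \<open>t\<close> replaces \<open>v\<close> by \<open>(U + V) v\<close>.\<close>

lemma gauss_pairing_nth:
  assumes "w \<in> D" "v \<in> D"
  shows "fps_nth (gauss_fps (- c / 2) * pairing_fps w v) k
    = cinner w (((\<lambda>x. U x + V x) ^^ k) v) / fact k"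
  using assms(2)
proof (induction k arbitrary: v)
  case 0
  then show ?case by (simp add: gauss_fps_def pairing_fps_def pairing_def)
next
  case (Suc k)
  let ?g = "gauss_fps (- c / 2)"
  \<comment> \<open>The Gaussian contributes -c t, which cancels the commutator term c t.\<close>
  have "fps_deriv (?g * pairing_fps w v) = ?g * pairing_fps w (U v + V v)
      + (fps_const c + fps_const (- c)) * (fps_X * ?g * pairing_fps w v)"
    using fps_deriv_gauss[of "- c / 2"] pairing_fps_deriv[OF assms(1) Suc.prems]
    by (simp add: algebra_simps del: fps_const_add)
  then have "fps_deriv (?g * pairing_fps w v) = ?g * pairing_fps w (U v + V v)"
    by simp
  then have "fps_nth (fps_deriv (?g * pairing_fps w v)) k = fps_nth (?g * pairing_fps w (U v + V v)) k"
    by simp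
  then have "of_nat (Suc k) * fps_nth (?g * pairing_fps w v) (Suc k)
      = cinner w (((\<lambda>x. U x + V x) ^^ k) (U v + V v)) / fact k"
    using Suc.IH[of "U v + V v"] Suc.prems
    by (simp only: fps_deriv_nth U_in V_in csubspaceD[OF D] Suc_eq_plus1)
  then show ?case
    by (simp add: funpow_Suc_right field_simps del: of_nat_Suc funpow.simps(2))
qed

end

section \<open>Operators with a common invariant domain\<close>

lemma op_app_simps [simp]:
  fixes A B :: "'h::chilbert operator"
  shows "op_app 0 v = 0" "op_app 1 v = v" "op_app (A + B) v = op_app A v + op_app B v"
    "op_app (A - B) v = op_app A v - op_app B v" "op_app (- A) v = - op_app A v"
    "op_app (A * B) v = op_app A (op_app B v)" "op_app (c *\<^sub>C A) v = c *\<^sub>C op_app A v"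
  by (simp_all add: zero_operator_def one_operator_def plus_operator_def minus_operator_def
      uminus_operator_def times_operator_def scaleC_operator_def)

lemma op_app_power: "op_app (A ^ n) v = (op_app A ^^ n) v"
  for A :: "'h::chilbert operator"
  by (induction n) simp_all

lemma leaves_invariant_intros:
  fixes A B :: "'h::chilbert operator"
  assumes "csubspace D"
  shows "leaves_invariant 0 D" "leaves_invariant 1 D"
    "leaves_invariant A D \<Longrightarrow> leaves_invariant (- A) D"
    "leaves_invariant A D \<Longrightarrow> leaves_invariant (c *\<^sub>C A) D"
    "leaves_invariant A D \<Longrightarrow> leaves_invariant B D \<Longrightarrow> leaves_invariant (A + B) D"
    "leaves_invariant A D \<Longrightarrow> leaves_invariant B D \<Longrightarrow> leaves_invariant (A - B) D"
    "leaves_invariant A D \<Longrightarrow> leaves_invariant B D \<Longrightarrow> leaves_invariant (A * B) D"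
  using csubspaceD[OF assms]
  by (auto simp: leaves_invariant_def zero_operator_def one_operator_def plus_operator_def
      minus_operator_def uminus_operator_def times_operator_def scaleC_operator_def)

lemma leaves_invariant_power:
  assumes "csubspace D" "leaves_invariant A D"
  shows "leaves_invariant (A ^ n) D"
  by (induction n) (simp_all add: leaves_invariant_intros assms)

lemma leaves_invariantD:
  assumes "leaves_invariant A D" "v \<in> D"
  shows "v \<in> op_dom A" "op_app A v \<in> D"
  using assms by (auto simp: leaves_invariant_def)

text \<open>Invariance places \<open>D\<close> inside the natural domains of both sides, so an
  operator identity reduces to an invariance check and an identity of vectors.\<close>

lemma agree_onI:
  assumes "leaves_invariant A D" "leaves_invariant B D" "\<And>v. v \<in> D \<Longrightarrow> op_app A v = op_app B v"
  shows "A \<doteq>\<^bsub>D\<^esub> B"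
  using assms by (auto simp: agree_on_def leaves_invariant_def)

section \<open>Linearity, congruence and symmetry of the exponential, and its product
  formula\<close>

lemma exp_op_sums:
  assumes "v \<in> op_dom (exp_op A)"
  shows "(\<lambda>n. op_app (A ^ n) v /\<^sub>R fact n) sums op_app (exp_op A) v"
    and "summable (\<lambda>n. norm (op_app (A ^ n) v /\<^sub>R fact n))"
proof -
  \<comment> \<open>The case t = 1 of the growth condition that defines entire vectors.\<close>
  have "summable (\<lambda>n. 1 ^ n * norm (op_app (A ^ n) v) / fact n)"
    using assms unfolding exp_op_def by (auto simp del: power_one)
  then show s: "summable (\<lambda>n. norm (op_app (A ^ n) v /\<^sub>R fact n))"
    by (simp add: field_simps)
  show "(\<lambda>n. op_app (A ^ n) v /\<^sub>R fact n) sums op_app (exp_op A) v"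
    using summable_sums[OF summable_norm_cancel[OF s]] by (simp add: exp_op_def)
qed

lemma exp_op_linear:
  assumes D: "csubspace D" and inv: "leaves_invariant A D" and lin: "clinear_on D (op_app A)"
    and dom: "D \<subseteq> op_dom (exp_op A)"
  shows "clinear_on D (op_app (exp_op A))"
proof -
  have "clinear_on D (op_app (A ^ n))" for n
  proof (induction n)
    case (Suc n)
    then show ?case
      using lin leaves_invariantD(2)[OF leaves_invariant_power[OF D inv]]
      unfolding clinear_on_def by simp
  qed (simp add: clinear_on_def)
  then have add: "op_app (A ^ n) (x + y) = op_app (A ^ n) x + op_app (A ^ n) y"
    and scale: "op_app (A ^ n) (c *\<^sub>C x) = c *\<^sub>C op_app (A ^ n) x"
    if "x \<in> D" "y \<in> D" for n x y c
    using that by (auto simp: clinear_on_def)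
  have "op_app (exp_op A) (x + y) = op_app (exp_op A) x + op_app (exp_op A) y"
    if "x \<in> D" "y \<in> D" for x y
  proof (rule sums_unique2)
    show "(\<lambda>n. op_app (A ^ n) (x + y) /\<^sub>R fact n) sums op_app (exp_op A) (x + y)"
      using that dom csubspaceD[OF D] by (intro exp_op_sums) auto
    show "(\<lambda>n. op_app (A ^ n) (x + y) /\<^sub>R fact n) sums (op_app (exp_op A) x + op_app (exp_op A) y)"
      using sums_add[OF exp_op_sums(1)[of x A] exp_op_sums(1)[of y A]] that dom
      by (simp add: add scaleR_add_right subset_eq)
  qed
  moreover have "op_app (exp_op A) (c *\<^sub>C x) = c *\<^sub>C op_app (exp_op A) x"
    if "x \<in> D" for c x
  proof (rule sums_unique2)
    show "(\<lambda>n. op_app (A ^ n) (c *\<^sub>C x) /\<^sub>R fact n) sums op_app (exp_op A) (c *\<^sub>C x)"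
      using that dom csubspaceD[OF D] by (intro exp_op_sums) auto
    show "(\<lambda>n. op_app (A ^ n) (c *\<^sub>C x) /\<^sub>R fact n) sums (c *\<^sub>C op_app (exp_op A) x)"
      using bounded_linear.sums[OF bounded_linear_scaleC exp_op_sums(1), of x A c] that dom
      by (simp add: scale subset_eq scaleR_scaleC scaleC_scaleC mult.commute)
  qed
  ultimately show ?thesis by (simp add: clinear_on_def)
qed

text \<open>Invariance under \<open>A\<close> puts \<open>D\<close> in the domains of all powers of
  \<open>A\<close>. The growth condition is inherited from \<open>B\<close>, because the powers
  agree on \<open>D\<close>.\<close>

lemma exp_op_cong:
  assumes D: "csubspace D" and A: "leaves_invariant A D"
    and eq: "\<And>v. v \<in> D \<Longrightarrow> op_app A v = op_app B v"
    and B: "D \<subseteq> op_dom (exp_op B)"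
  shows "exp_op A \<doteq>\<^bsub>D\<^esub> exp_op B"
proof -
  have pow: "op_app (A ^ n) v = op_app (B ^ n) v" if "v \<in> D" for n v
    using that
    by (induction n) (use leaves_invariantD(2)[OF leaves_invariant_power[OF D A]] eq in \<open>simp_all, metis\<close>)
  have "v \<in> op_dom (A ^ n)" if "v \<in> D" for n v
    using leaves_invariantD(1)[OF leaves_invariant_power[OF D A] that] .
  then show ?thesis
    using B unfolding agree_on_def by (auto simp: exp_op_def pow)
qed

lemma exp_op_symmetric:
  assumes D: "csubspace D" and inv: "leaves_invariant A D" and sym: "symmetric_on D (op_app A)"
    and dom: "D \<subseteq> op_dom (exp_op A)"
  shows "symmetric_on D (op_app (exp_op A))"
proof -
  have "symmetric_on D (op_app (A ^ n))" for n
  proof (induction n)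
    case (Suc n)
    then show ?case
      using sym leaves_invariantD(2)[OF leaves_invariant_power[OF D inv]]
        leaves_invariantD(2)[OF inv]
      unfolding symmetric_on_def by (simp add: op_app_power funpow_swap1)
  qed (simp add: symmetric_on_def)
  then have pow: "cinner (op_app (A ^ n) x) y = cinner x (op_app (A ^ n) y)"
    if "x \<in> D" "y \<in> D" for n x y
    using that by (auto simp: symmetric_on_def)
  show ?thesis
    unfolding symmetric_on_def
  proof (intro ballI)
    fix x y assume xy: "x \<in> D" "y \<in> D"
    show "cinner (op_app (exp_op A) x) y = cinner x (op_app (exp_op A) y)"
    proof (rule sums_unique2)
      show "(\<lambda>n. cinner x (op_app (A ^ n) y /\<^sub>R fact n)) sums cinner x (op_app (exp_op A) y)"
        using xy dom by (intro bounded_linear.sums[OF cinner.bounded_linear_right] exp_op_sums) auto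
      have "(\<lambda>n. cinner (op_app (A ^ n) x /\<^sub>R fact n) y) sums cinner (op_app (exp_op A) x) y"
        using xy dom by (intro bounded_linear.sums[OF cinner.bounded_linear_left] exp_op_sums) auto
      then show "(\<lambda>n. cinner x (op_app (A ^ n) y /\<^sub>R fact n)) sums cinner (op_app (exp_op A) x) y"
        using xy by (simp add: pow cinner.scaleR_left cinner.scaleR_right)
    qed
  qed
qed

theorem exp_op_mult:
  fixes U V W :: "'h::chilbert operator"
  assumes D: "csubspace D" "closure D = UNIV"
    and inv: "leaves_invariant U D" "leaves_invariant V D" "leaves_invariant (exp_op V) D"
    and dom: "D \<subseteq> op_dom (exp_op U)" "D \<subseteq> op_dom (exp_op W)"
    and lin: "clinear_on D (op_app V)"
    and sym: "symmetric_on D (op_app U)"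
    and comm: "\<And>v. v \<in> D \<Longrightarrow> op_app U (op_app V v) - op_app V (op_app U v) = c *\<^sub>C v"
    and W: "\<And>v. v \<in> D \<Longrightarrow> op_app W v = op_app U v + op_app V v"
    and v: "v \<in> D"
  shows "op_app (exp_op U) (op_app (exp_op V) v) = exp (c / 2) *\<^sub>C op_app (exp_op W) v"
proof (rule eq_if_cinner_dense[OF D(2)])
  fix w assume w: "w \<in> D"
  interpret canonical_pair D "op_app U" "op_app V" c
    by unfold_locales (use D inv lin sym comm leaves_invariantD in auto)
  let ?x = "\<lambda>n. op_app (U ^ n) w /\<^sub>R fact n" and ?y = "\<lambda>n. op_app (V ^ n) v /\<^sub>R fact n"
  have wU: "w \<in> op_dom (exp_op U)" and vV: "v \<in> op_dom (exp_op V)" and vW: "v \<in> op_dom (exp_op W)"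
    using w v dom leaves_invariantD(1)[OF inv(3)] by auto
  have xy: "cinner (?x i) (?y j) = pairing w v i j" for i j
    by (simp add: pairing_def op_app_power cinner.scaleR_left cinner.scaleR_right
        scaleR_conv_of_real field_simps)
  have sums: "(\<lambda>k. fps_nth (pairing_fps w v) k) sums cinner (op_app (exp_op U) w) (op_app (exp_op V) v)"
    using bounded_bilinear_Cauchy_product_sums[OF bounded_bilinear_cinner
        exp_op_sums(2,1)[OF wU] exp_op_sums(2,1)[OF vV]]
    by (simp add: xy pairing_fps_def)
  \<comment> \<open>Absolute convergence allows this series to be multiplied by the Gaussian
    one.\<close>
  have abs: "summable (\<lambda>k. norm (fps_nth (pairing_fps w v) k))"
  proof (rule summable_comparison_test'[where N = 0])
    show "summable (\<lambda>k. \<Sum>i\<le>k. norm (?x i) * norm (?y (k - i)))"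
      by (rule summable_Cauchy_product) (use exp_op_sums(2)[OF wU] exp_op_sums(2)[OF vV] in simp_all)
    have "norm (fps_nth (pairing_fps w v) k) \<le> (\<Sum>i\<le>k. norm (?x i) * norm (?y (k - i)))" for k
      unfolding pairing_fps_def fps_nth_Abs_fps xy[symmetric]
      by (intro order.trans[OF norm_sum] sum_mono norm_cinner_le)
    then show "norm (norm (fps_nth (pairing_fps w v) k))
        \<le> (\<Sum>i\<le>k. norm (?x i) * norm (?y (k - i)))" for k
      by (simp only: real_norm_def abs_norm_cancel)
  qed
  have "(\<lambda>k. fps_nth (gauss_fps (- c / 2) * pairing_fps w v) k) sums
      (exp (- c / 2) * cinner (op_app (exp_op U) w) (op_app (exp_op V) v))"
    using Cauchy_product_sums[OF gauss_fps_sums(2) abs]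
      sums_unique[OF sums] sums_unique[OF gauss_fps_sums(1)]
    by (simp add: fps_mult_nth atLeast0AtMost)
  moreover have "(\<lambda>k. fps_nth (gauss_fps (- c / 2) * pairing_fps w v) k) sums cinner w (op_app (exp_op W) v)"
  proof -
    \<comment> \<open>\<open>W\<close> is known only through its values on \<open>D\<close>, so the
      induction carries membership in \<open>D\<close> along.\<close>
    have pow: "op_app (W ^ k) v = ((\<lambda>x. op_app U x + op_app V x) ^^ k) v
        \<and> op_app (W ^ k) v \<in> D" for k
      by (induction k) (use v W inv D in \<open>auto simp: leaves_invariant_def csubspaceD\<close>)
    have "(\<lambda>k. cinner w (op_app (W ^ k) v /\<^sub>R fact k)) sums cinner w (op_app (exp_op W) v)"
      by (intro bounded_linear.sums[OF cinner.bounded_linear_right] exp_op_sums vW)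
    then show ?thesis
      unfolding gauss_pairing_nth[OF w v]
      by (simp add: pow cinner.scaleR_right scaleR_conv_of_real field_simps)
  qed
  ultimately have "exp (- c / 2) * cinner (op_app (exp_op U) w) (op_app (exp_op V) v)
      = cinner w (op_app (exp_op W) v)"
    by (rule sums_unique2)
  \<comment> \<open>The exponential of \<open>U\<close> returns from the test vector to the right
    slot.\<close>
  moreover have "cinner (op_app (exp_op U) w) (op_app (exp_op V) v)
      = cinner w (op_app (exp_op U) (op_app (exp_op V) v))"
    using exp_op_symmetric[OF D(1) inv(1) sym dom(1)] w leaves_invariantD(2)[OF inv(3) v]
    by (simp add: symmetric_on_def)
  ultimately show "cinner w (op_app (exp_op U) (op_app (exp_op V) v))
      = cinner w (exp (c / 2) *\<^sub>C op_app (exp_op W) v)"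
    by (simp add: cinner_scaleC_right exp_minus field_simps)
qed

section \<open>The quantum torus of three self-adjoint operators\<close>

lemma selfadjoint_clinear_on:
  assumes "selfadjoint A" "D \<subseteq> op_dom A"
  shows "clinear_on D (op_app A)"
  using assms unfolding selfadjoint_def densely_defined_linear_def clinear_on_def by blast

lemma selfadjoint_symmetric_on:
  assumes "selfadjoint A" "D \<subseteq> op_dom A"
  shows "symmetric_on D (op_app A)"
  using assms unfolding selfadjoint_def adjoint_graph_def symmetric_on_def by blast

locale weyl_triple =
  fixes D :: "'h::chilbert set" and X Y Z :: "'h operator" and hbar :: real
  assumes selfadjoint: "selfadjoint X" "selfadjoint Y" "selfadjoint Z"
    and dom: "common_exp_domain D X Y Z"
    and commutators:
      "X * Y - Y * X \<doteq>\<^bsub>D\<^esub> (2 * pi * \<i> * hbar) *\<^sub>C 1"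
      "Y * Z - Z * Y \<doteq>\<^bsub>D\<^esub> (2 * pi * \<i> * hbar) *\<^sub>C 1"
      "Z * X - X * Z \<doteq>\<^bsub>D\<^esub> (2 * pi * \<i> * hbar) *\<^sub>C 1"
begin

definition lin :: "real \<Rightarrow> real \<Rightarrow> real \<Rightarrow> 'h operator" where
  "lin x y z = complex_of_real x *\<^sub>C X + complex_of_real y *\<^sub>C Y + complex_of_real z *\<^sub>C Z"

definition E :: "real \<Rightarrow> real \<Rightarrow> real \<Rightarrow> 'h \<Rightarrow> 'h" where
  "E x y z = op_app (exp_op (lin x y z))"

text \<open>The power q^t for real t with a fixed branch. The half exponents in the edge matrices
  produce fractional powers of q.\<close>

definition phase :: "real \<Rightarrow> complex" where
  "phase t = exp (\<i> * pi * hbar * t)"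

lemma phase_scaleC:
  "phase s *\<^sub>C phase t *\<^sub>C (v::'h) = phase (s + t) *\<^sub>C v" "phase 0 *\<^sub>C v = v"
  by (simp_all add: phase_def scaleC_scaleC exp_add[symmetric] algebra_simps)

lemma csubspace: "csubspace D" and dense: "closure D = UNIV"
  and inv: "leaves_invariant X D" "leaves_invariant Y D" "leaves_invariant Z D"
  and lin_exp_invariant: "leaves_invariant (exp_op (lin x y z)) D"
  using dom unfolding common_exp_domain_def lin_def by blast+

lemmas D_closed [simp] = csubspaceD[OF csubspace]

lemma E_in [simp]: "v \<in> D \<Longrightarrow> E x y z v \<in> D"
  unfolding E_def using leaves_invariantD(2)[OF lin_exp_invariant] .

lemma linear: "clinear_on D (op_app X)" "clinear_on D (op_app Y)" "clinear_on D (op_app Z)"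
  and symmetric: "symmetric_on D (op_app X)" "symmetric_on D (op_app Y)" "symmetric_on D (op_app Z)"
  using selfadjoint inv
  by (auto intro!: selfadjoint_clinear_on selfadjoint_symmetric_on simp: leaves_invariant_def)

lemma lin_invariant: "leaves_invariant (lin x y z) D"
  unfolding lin_def by (intro leaves_invariant_intros csubspace inv)

lemma in_D [simp]:
  "v \<in> D \<Longrightarrow> op_app X v \<in> D" "v \<in> D \<Longrightarrow> op_app Y v \<in> D" "v \<in> D \<Longrightarrow> op_app Z v \<in> D"
  using inv by (auto dest: leaves_invariantD(2))

lemma linD:
  assumes "u \<in> D" "v \<in> D"
  shows "op_app X (u + v) = op_app X u + op_app X v" "op_app X (c *\<^sub>C v) = c *\<^sub>C op_app X v"
    "op_app Y (u + v) = op_app Y u + op_app Y v" "op_app Y (c *\<^sub>C v) = c *\<^sub>C op_app Y v"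
    "op_app Z (u + v) = op_app Z u + op_app Z v" "op_app Z (c *\<^sub>C v) = c *\<^sub>C op_app Z v"
  using linear assms unfolding clinear_on_def by auto

lemma lin_clinear_on: "clinear_on D (op_app (lin x y z))"
  unfolding clinear_on_def lin_def
  by (auto simp: linD scaleC_add_right scaleC_scaleC algebra_simps)

lemma lin_symmetric_on: "symmetric_on D (op_app (lin x y z))"
  using symmetric unfolding symmetric_on_def lin_def
  by (auto simp: cinner_add_left cinner_add_right cinner_scaleC_left cinner_scaleC_right)

text \<open>The real factor is the determinant with rows (1,1,1), (a,b,c), (x,y,z). It vanishes when
  (a,b,c) is a multiple of (1,1,1), which is the source of the central elements.\<close>

lemma lin_commutator:
  assumes "v \<in> D"
  shows "op_app (lin a b c) (op_app (lin x y z) v) - op_app (lin x y z) (op_app (lin a b c) v)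
    = (2 * pi * \<i> * hbar * complex_of_real (a * y - b * x + b * z - c * y + c * x - a * z)) *\<^sub>C v"
proof -
  define k where "k = complex_of_real (2 * pi) * \<i> * hbar"
  have *: "op_app X (op_app Y v) = op_app Y (op_app X v) + k *\<^sub>C v"
    "op_app Y (op_app Z v) = op_app Z (op_app Y v) + k *\<^sub>C v"
    "op_app Z (op_app X v) = op_app X (op_app Z v) + k *\<^sub>C v"
    using commutators assms by (auto simp: agree_on_def k_def algebra_simps)
  have "op_app (lin a b c) (op_app (lin x y z) v) - op_app (lin x y z) (op_app (lin a b c) v)
    = (complex_of_real (a * y - b * x + b * z - c * y + c * x - a * z) * k) *\<^sub>C v"
    using assms
    by (simp add: lin_def linD * scaleC_add_right scaleC_add_left scaleC_diff_left
        scaleC_scaleC algebra_simps)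
  then show ?thesis by (simp add: k_def algebra_simps)
qed

text \<open>The half in the Weyl relation cancels the 2 in the commutator, so the exponent of q is
  exactly the determinant of \<open>lin_commutator\<close>.\<close>

lemma E_mult:
  assumes "v \<in> D"
  shows "E a b c (E x y z v)
    = phase (a * y - b * x + b * z - c * y + c * x - a * z) *\<^sub>C E (a + x) (b + y) (c + z) v"
proof -
  let ?s = "complex_of_real (a * y - b * x + b * z - c * y + c * x - a * z)"
  have "E a b c (E x y z v) = exp (2 * pi * \<i> * hbar * ?s / 2) *\<^sub>C E (a + x) (b + y) (c + z) v"
    unfolding E_def
  proof (rule exp_op_mult[OF csubspace dense lin_invariant lin_invariant lin_exp_invariant
        _ _ lin_clinear_on lin_symmetric_on lin_commutator _ assms])
    show "op_app (lin (a + x) (b + y) (c + z)) v = op_app (lin a b c) v + op_app (lin x y z) v" for v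
      by (simp add: lin_def scaleC_add_left)
  qed (use lin_exp_invariant in \<open>auto simp: leaves_invariant_def\<close>)
  also have "2 * pi * \<i> * hbar * ?s / 2 = \<i> * pi * hbar * ?s"
    by simp
  finally show ?thesis
    by (simp only: phase_def)
qed

lemma E_clinear_on: "clinear_on D (E x y z)"
  unfolding E_def
  by (rule exp_op_linear[OF csubspace lin_invariant lin_clinear_on])
    (use lin_exp_invariant in \<open>auto simp: leaves_invariant_def\<close>)

lemma E_linear:
  assumes "u \<in> D" "v \<in> D"
  shows "E x y z (u + v) = E x y z u + E x y z v" "E x y z (u - v) = E x y z u - E x y z v"
    "E x y z (- v) = - E x y z v" "E x y z (c *\<^sub>C v) = c *\<^sub>C E x y z v" "E x y z 0 = 0"
proof -
  show "E x y z (u + v) = E x y z u + E x y z v" and s: "E x y z (c *\<^sub>C v) = c *\<^sub>C E x y z v" for c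
    using E_clinear_on assms unfolding clinear_on_def by blast+
  show "E x y z (u - v) = E x y z u - E x y z v" "E x y z (- v) = - E x y z v"
    using clinear_on_diff[OF E_clinear_on csubspace assms] clinear_on_minus[OF E_clinear_on assms(2)]
    by blast+
  show "E x y z 0 = 0"
    using s[of 0] by simp
qed

lemma E_zero [simp]: "E 0 0 0 v = v"
proof -
  have pow: "op_app (lin 0 0 0 ^ n) v = (if n = 0 then v else 0)" for n
    by (cases n) (simp_all add: lin_def)
  have "(\<lambda>n. op_app (lin 0 0 0 ^ n) v /\<^sub>R fact n) sums (op_app (lin 0 0 0 ^ 0) v /\<^sub>R fact 0)"
    by (rule sums_single[of 0 "\<lambda>n. op_app (lin 0 0 0 ^ n) v /\<^sub>R fact n", THEN sums_cong[THEN iffD1, rotated]])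
      (simp add: pow)
  then show ?thesis
    by (simp add: E_def exp_op_def sums_iff)
qed

text \<open>A combination such as \<open>X - Z\<close> may have a larger domain than
  \<open>lin 1 0 (- 1)\<close>, since a zero multiple of \<open>Y\<close> still carries the domain
  of \<open>Y\<close>. On \<open>D\<close> the exponentials nevertheless agree.\<close>

lemma exp_op_eq_E:
  assumes "leaves_invariant A D" "\<And>v. v \<in> D \<Longrightarrow> op_app A v = op_app (lin x y z) v"
  shows "leaves_invariant (exp_op A) D" "v \<in> D \<Longrightarrow> op_app (exp_op A) v = E x y z v"
proof -
  have "exp_op A \<doteq>\<^bsub>D\<^esub> exp_op (lin x y z)"
    by (rule exp_op_cong[OF csubspace assms]) (use lin_exp_invariant in \<open>auto simp: leaves_invariant_def\<close>)
  then show "leaves_invariant (exp_op A) D" "v \<in> D \<Longrightarrow> op_app (exp_op A) v = E x y z v"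
    using lin_exp_invariant[of x y z] by (auto simp: agree_on_def leaves_invariant_def E_def)
qed

lemma exp_op_monomial:
  assumes "leaves_invariant A D" "\<And>v. v \<in> D \<Longrightarrow> op_app A v = op_app (lin x y z) v"
  shows "leaves_invariant (exp_op A) D \<and> (\<forall>v\<in>D. op_app (exp_op A) v = E x y z v)"
  using exp_op_eq_E[OF assms] by blast

lemma exp_op_monomials:
  shows "leaves_invariant (exp_op X) D \<and> (\<forall>v\<in>D. op_app (exp_op X) v = E 1 0 0 v)"
    and "leaves_invariant (exp_op Y) D \<and> (\<forall>v\<in>D. op_app (exp_op Y) v = E 0 1 0 v)"
    and "leaves_invariant (exp_op (- X)) D \<and> (\<forall>v\<in>D. op_app (exp_op (- X)) v = E (- 1) 0 0 v)"
    and "leaves_invariant (exp_op (- Z)) D \<and> (\<forall>v\<in>D. op_app (exp_op (- Z)) v = E 0 0 (- 1) v)"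
    and "leaves_invariant (exp_op (X - Z)) D \<and> (\<forall>v\<in>D. op_app (exp_op (X - Z)) v = E 1 0 (- 1) v)"
    and "leaves_invariant (exp_op (X + Z)) D \<and> (\<forall>v\<in>D. op_app (exp_op (X + Z)) v = E 1 0 1 v)"
    and "leaves_invariant (exp_op (X + Y)) D \<and> (\<forall>v\<in>D. op_app (exp_op (X + Y)) v = E 1 1 0 v)"
    and "leaves_invariant (exp_op (- X - Z)) D
      \<and> (\<forall>v\<in>D. op_app (exp_op (- X - Z)) v = E (- 1) 0 (- 1) v)"
    and "leaves_invariant (exp_op (- X - Y)) D
      \<and> (\<forall>v\<in>D. op_app (exp_op (- X - Y)) v = E (- 1) (- 1) 0 v)"
    and "leaves_invariant (exp_op (- X + Y)) D
      \<and> (\<forall>v\<in>D. op_app (exp_op (- X + Y)) v = E (- 1) 1 0 v)"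
  by (rule exp_op_monomial;
      simp add: leaves_invariant_intros csubspace inv lin_def scaleC_minus_left)+

section \<open>Edge matrices in terms of monomials with half exponents\<close>

lemma edge_mat_eq_E:
  assumes "leaves_invariant A D" "\<And>v. v \<in> D \<Longrightarrow> op_app A v = op_app (lin x y z) v"
  shows "leaves_invariant (edge_mat A $ i $ j) D"
    "op_app (edge_mat A $ 1 $ 1) v = 0" "op_app (edge_mat A $ 2 $ 2) v = 0"
    "v \<in> D \<Longrightarrow> op_app (edge_mat A $ 1 $ 2) v = - E (x / 2) (y / 2) (z / 2) v"
    "v \<in> D \<Longrightarrow> op_app (edge_mat A $ 2 $ 1) v = E (- x / 2) (- y / 2) (- z / 2) v"
proof -
  have pos: "op_app ((1 / 2) *\<^sub>C A) v = op_app (lin (x / 2) (y / 2) (z / 2)) v"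
    and neg: "op_app ((- 1 / 2) *\<^sub>C A) v = op_app (lin (- x / 2) (- y / 2) (- z / 2)) v" if "v \<in> D" for v
    by (simp_all add: assms(2)[OF that] lin_def scaleC_add_right scaleC_scaleC)
  have inv2: "leaves_invariant (c *\<^sub>C A) D" for c
    by (intro leaves_invariant_intros csubspace assms)
  note P = exp_op_eq_E[OF inv2 pos] and N = exp_op_eq_E[OF inv2 neg]
  show "leaves_invariant (edge_mat A $ i $ j) D"
    using exhaust_2[of i] exhaust_2[of j] P(1) N(1)
    by (auto simp: edge_mat_def intro!: leaves_invariant_intros csubspace)
  show "op_app (edge_mat A $ 1 $ 1) v = 0" "op_app (edge_mat A $ 2 $ 2) v = 0"
    by (simp_all add: edge_mat_def)
  show "op_app (edge_mat A $ 1 $ 2) v = - E (x / 2) (y / 2) (z / 2) v"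
    "op_app (edge_mat A $ 2 $ 1) v = E (- x / 2) (- y / 2) (- z / 2) v" if "v \<in> D"
    using P(2)[OF _ that] N(2)[OF _ that] by (simp_all add: edge_mat_def)
qed

lemma edge_mat_X:
  "leaves_invariant (edge_mat X $ i $ j) D"
  "op_app (edge_mat X $ 1 $ 1) v = 0" "op_app (edge_mat X $ 2 $ 2) v = 0"
  "v \<in> D \<Longrightarrow> op_app (edge_mat X $ 1 $ 2) v = - E (1 / 2) 0 0 v"
  "v \<in> D \<Longrightarrow> op_app (edge_mat X $ 2 $ 1) v = E (- 1 / 2) 0 0 v"
  using edge_mat_eq_E[of X 1 0 0] inv by (simp_all add: lin_def)

lemma edge_mat_Y:
  "leaves_invariant (edge_mat Y $ i $ j) D"
  "op_app (edge_mat Y $ 1 $ 1) v = 0" "op_app (edge_mat Y $ 2 $ 2) v = 0"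
  "v \<in> D \<Longrightarrow> op_app (edge_mat Y $ 1 $ 2) v = - E 0 (1 / 2) 0 v"
  "v \<in> D \<Longrightarrow> op_app (edge_mat Y $ 2 $ 1) v = E 0 (- 1 / 2) 0 v"
  using edge_mat_eq_E[of Y 0 1 0] inv by (simp_all add: lin_def)

lemma edge_mat_Z:
  "leaves_invariant (edge_mat Z $ i $ j) D"
  "op_app (edge_mat Z $ 1 $ 1) v = 0" "op_app (edge_mat Z $ 2 $ 2) v = 0"
  "v \<in> D \<Longrightarrow> op_app (edge_mat Z $ 1 $ 2) v = - E 0 0 (1 / 2) v"
  "v \<in> D \<Longrightarrow> op_app (edge_mat Z $ 2 $ 1) v = E 0 0 (- 1 / 2) v"
  using edge_mat_eq_E[of Z 0 0 1] inv by (simp_all add: lin_def)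

end

section \<open>The monodromy matrices\<close>

lemma opmat_mult_app:
  fixes A B :: "('h::chilbert operator)^2^2"
  shows "op_app ((A \<star>\<star> B) $ i $ j) v
    = op_app (A $ i $ 1) (op_app (B $ 1 $ j) v) + op_app (A $ i $ 2) (op_app (B $ 2 $ j) v)"
  by (simp add: opmat_mult_def)

lemma opmat_mult_invariant:
  assumes "csubspace D"
    and "\<And>i j. leaves_invariant (A $ i $ j) D" "\<And>i j. leaves_invariant (B $ i $ j) D"
  shows "leaves_invariant ((A \<star>\<star> B) $ i $ j) D"
  using assms by (simp add: opmat_mult_def leaves_invariant_intros)

lemma scalar_opmat_app: "op_app (scalar_opmat A $ i $ j) v = (A $ i $ j) *\<^sub>C v"
  by (simp add: scalar_opmat_def)

lemma scalar_opmat_invariant: "csubspace D \<Longrightarrow> leaves_invariant (scalar_opmat A $ i $ j) D"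
  by (simp add: scalar_opmat_def leaves_invariant_intros)

lemma R_num_nth:
  "R_num $ 1 $ 1 = 1" "R_num $ 1 $ 2 = 1" "R_num $ 2 $ 1 = - 1" "R_num $ 2 $ 2 = 0"
  "(R_num ** R_num) $ 1 $ 1 = 0" "(R_num ** R_num) $ 1 $ 2 = 1"
  "(R_num ** R_num) $ 2 $ 1 = - 1" "(R_num ** R_num) $ 2 $ 2 = - 1"
  by (simp_all add: R_num_def matrix_matrix_mult_def sum_2)

theorem mainTheorem11:
  fixes hbar w1 w2 :: real and q :: complex
    and X Y Z :: "'h::chilbert operator" and D :: "'h set"
    and a1 b1 c1 a2 b2 c2 K1 K2 :: "'h operator"
    and M1 M2 :: "'h operator^2^2"
  assumes hbar: "hbar > 0"
    and q: "q = exp (\<i> * pi * hbar)"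
    and selfadjoint: "selfadjoint X" "selfadjoint Y" "selfadjoint Z"
    and dom: "common_exp_domain D X Y Z"
    and commutators:
      "X * Y - Y * X \<doteq>\<^bsub>D\<^esub> (2 * pi * \<i> * hbar) *\<^sub>C 1"
      "Y * Z - Z * Y \<doteq>\<^bsub>D\<^esub> (2 * pi * \<i> * hbar) *\<^sub>C 1"
      "Z * X - X * Z \<doteq>\<^bsub>D\<^esub> (2 * pi * \<i> * hbar) *\<^sub>C 1"
    and M1: "M1 = monodromy1 w1 X Y Z"
    and M2: "M2 = monodromy2 w2 X Y Z"
    and a1: "a1 = exp_op (- Z)"
    and b1: "b1 = exp_op (X - Z) + exp_op (X + Z) + complex_of_real w1 *\<^sub>C exp_op X"
    and c1: "c1 = exp_op (- X - Z)"
    and a2: "a2 = exp_op Y"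
    and b2: "b2 = exp_op (X + Y)"
    and c2: "c2 = exp_op (- X - Y) + exp_op (- X + Y) + complex_of_real w2 *\<^sub>C exp_op (- X)"
    and K1: "K1 = a1 * c2 - q^2 *\<^sub>C (c1 * a2) - (q * w2) *\<^sub>C c1"
    and K2: "K2 = a2 * b1 - (inverse q)^2 *\<^sub>C (b2 * a1) - (inverse q * w1) *\<^sub>C b2"
  shows "M1 \<doteq>\<doteq>\<^bsub>D\<^esub> monodromy_form q w1 a1 b1 c1 \<and>
    M2 \<doteq>\<doteq>\<^bsub>D\<^esub> monodromy_form q w2 a2 b2 c2 \<and>
    deformed_sl2_relations D q w1 a1 b1 c1 \<and>
    deformed_sl2_relations D q w2 a2 b2 c2 \<and>
    inverse q *\<^sub>C (a1 * a2) \<doteq>\<^bsub>D\<^esub> q *\<^sub>C (a2 * a1) \<and>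
    inverse q *\<^sub>C (b1 * b2) \<doteq>\<^bsub>D\<^esub> q *\<^sub>C (b2 * b1) \<and>
    inverse q *\<^sub>C (c1 * c2) \<doteq>\<^bsub>D\<^esub> q *\<^sub>C (c2 * c1) \<and>
    a1 * b2 \<doteq>\<^bsub>D\<^esub> b2 * a1 \<and>
    c1 * a2 \<doteq>\<^bsub>D\<^esub> a2 * c1 \<and>
    q *\<^sub>C (c1 * b2) \<doteq>\<^bsub>D\<^esub> inverse q *\<^sub>C (b2 * c1) \<and>
    b1 * a2 + (inverse q)^2 *\<^sub>C (a1 * b2) + (w1 * inverse q) *\<^sub>C b2
      \<doteq>\<^bsub>D\<^esub> a2 * b1 + q^2 *\<^sub>C (b2 * a1) + (w1 * q) *\<^sub>C b2 \<and>
    a1 * c2 + (inverse q)^2 *\<^sub>C (c1 * a2) + (w2 * inverse q) *\<^sub>C c1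
      \<doteq>\<^bsub>D\<^esub> c2 * a1 + q^2 *\<^sub>C (a2 * c1) + (w2 * q) *\<^sub>C c1 \<and>
    q *\<^sub>C (b1 * c2) - inverse q *\<^sub>C (c2 * b1)
      \<doteq>\<^bsub>D\<^esub> (q^2 - (inverse q)^2) *\<^sub>C
            (q *\<^sub>C (a1 * a2) + inverse q *\<^sub>C (a2 * a1)
             + complex_of_real w1 *\<^sub>C a2 + complex_of_real w2 *\<^sub>C a1)
          + ((q - inverse q) * w1 * w2) *\<^sub>C 1 \<and>
    a1 * a2 \<doteq>\<^bsub>D\<^esub> q^2 *\<^sub>C (c1 * b2) \<and>
    (\<forall>K \<in> {K1, K2}. \<forall>T \<in> {a1, b1, c1, a2, b2, c2}. K * T \<doteq>\<^bsub>D\<^esub> T * K) \<and>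
    K1 * K2 \<doteq>\<^bsub>D\<^esub> 1"
proof -
  interpret weyl_triple D X Y Z hbar
    by unfold_locales (fact selfadjoint dom commutators)+
  note closed = leaves_invariant_intros[OF csubspace]
  \<comment> \<open>Powers of q become phases, so that multiplying scalars amounts to adding
    exponents.\<close>
  have q1: "q = phase 1" and qi: "inverse q = phase (- 1)"
    by (simp_all add: q phase_def exp_minus)
  have q2: "q\<^sup>2 = phase 2" and qi2: "(inverse q)\<^sup>2 = phase (- 2)"
    by (simp_all add: q phase_def exp_minus[symmetric] exp_of_nat_mult[of 2, symmetric] mult_ac
        del: exp_minus_inverse)
  \<comment> \<open>The next two facts fix a normal order of scalars: the phase outermost, then
    \<open>w1\<close>, then \<open>w2\<close>.\<close>
  have ph: "complex_of_real w *\<^sub>C phase t *\<^sub>C (v::'h) = phase t *\<^sub>C complex_of_real w *\<^sub>C v" for w t v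
    by (simp add: scaleC_scaleC mult.commute)
  have ww: "complex_of_real w2 *\<^sub>C complex_of_real w1 *\<^sub>C (v::'h)
      = complex_of_real w1 *\<^sub>C complex_of_real w2 *\<^sub>C v" for v
    by (simp add: scaleC_scaleC mult.commute)
  have scaleC_mult: "(c * d) *\<^sub>C (v::'h) = c *\<^sub>C d *\<^sub>C v" for c d v
    by (simp add: scaleC_scaleC)
  note norm = E_linear E_mult scaleC_add_left scaleC_add_right scaleC_diff_left scaleC_diff_right
    scaleC_minus_left scaleC_minus_right scaleC_mult ph ww phase_scaleC

  note mon = exp_op_monomials
  have inv1: "leaves_invariant a1 D" "leaves_invariant b1 D" "leaves_invariant c1 D"
    and inv2: "leaves_invariant a2 D" "leaves_invariant b2 D" "leaves_invariant c2 D"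
    unfolding a1 b1 c1 a2 b2 c2 using mon by (simp_all add: closed)
  have app: "op_app a1 v = E 0 0 (- 1) v"
    "op_app b1 v = E 1 0 (- 1) v + E 1 0 1 v + complex_of_real w1 *\<^sub>C E 1 0 0 v"
    "op_app c1 v = E (- 1) 0 (- 1) v"
    "op_app a2 v = E 0 1 0 v"
    "op_app b2 v = E 1 1 0 v"
    "op_app c2 v = E (- 1) (- 1) 0 v + E (- 1) 1 0 v + complex_of_real w2 *\<^sub>C E (- 1) 0 0 v"
    if "v \<in> D" for v
    unfolding a1 b1 c1 a2 b2 c2 using mon that by simp_all
  note invs = closed inv1 inv2
  have K1_inv: "leaves_invariant K1 D" and K2_inv: "leaves_invariant K2 D"
    unfolding K1 K2 by (simp_all add: closed inv1 inv2)
  \<comment> \<open>The terms of \<open>a1 * c2\<close> coming from exp (- X + Y) and exp (- X)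
    carry the phases q^2 and q, and the two subtracted terms cancel them. The remaining product has
    phase 1.\<close>
  have K1_app: "op_app K1 v = E (- 1) (- 1) (- 1) v" if "v \<in> D" for v
    using that unfolding K1 q2 unfolding q1 by (simp add: app norm)
  have K2_app: "op_app K2 v = E 1 1 1 v" if "v \<in> D" for v
    using that unfolding K2 qi2 unfolding qi by (simp add: app norm)
  have sq: "op_app (A\<^sup>2) v = op_app A (op_app A v)" for A :: "'h operator" and v
    by (simp add: op_app_power numeral_2_eq_2)
  note rep = app K1_app K2_app
  have sl2_1: "deformed_sl2_relations D q w1 a1 b1 c1"
    unfolding deformed_sl2_relations_def q2 qi2 unfolding qi unfolding q1
    by (intro conjI agree_onI; simp add: invs leaves_invariant_power[OF csubspace] sq rep norm)
  have sl2_2: "deformed_sl2_relations D q w2 a2 b2 c2"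
    unfolding deformed_sl2_relations_def q2 qi2 unfolding qi unfolding q1
    by (intro conjI agree_onI; simp add: invs leaves_invariant_power[OF csubspace] sq rep norm)
  have q_commute: "inverse q *\<^sub>C (a1 * a2) \<doteq>\<^bsub>D\<^esub> q *\<^sub>C (a2 * a1)"
    "inverse q *\<^sub>C (b1 * b2) \<doteq>\<^bsub>D\<^esub> q *\<^sub>C (b2 * b1)"
    "inverse q *\<^sub>C (c1 * c2) \<doteq>\<^bsub>D\<^esub> q *\<^sub>C (c2 * c1)"
    "a1 * b2 \<doteq>\<^bsub>D\<^esub> b2 * a1"
    "c1 * a2 \<doteq>\<^bsub>D\<^esub> a2 * c1"
    "q *\<^sub>C (c1 * b2) \<doteq>\<^bsub>D\<^esub> inverse q *\<^sub>C (b2 * c1)"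
    unfolding qi unfolding q1
    by (rule agree_onI; simp add: invs rep norm)+
  have mixed: "b1 * a2 + (inverse q)^2 *\<^sub>C (a1 * b2) + (w1 * inverse q) *\<^sub>C b2
      \<doteq>\<^bsub>D\<^esub> a2 * b1 + q^2 *\<^sub>C (b2 * a1) + (w1 * q) *\<^sub>C b2"
    "a1 * c2 + (inverse q)^2 *\<^sub>C (c1 * a2) + (w2 * inverse q) *\<^sub>C c1
      \<doteq>\<^bsub>D\<^esub> c2 * a1 + q^2 *\<^sub>C (a2 * c1) + (w2 * q) *\<^sub>C c1"
    unfolding q2 qi2 unfolding qi unfolding q1
    by (rule agree_onI; simp add: invs rep norm)+
  have b1_c2: "q *\<^sub>C (b1 * c2) - inverse q *\<^sub>C (c2 * b1)
      \<doteq>\<^bsub>D\<^esub> (q^2 - (inverse q)^2) *\<^sub>C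
            (q *\<^sub>C (a1 * a2) + inverse q *\<^sub>C (a2 * a1)
             + complex_of_real w1 *\<^sub>C a2 + complex_of_real w2 *\<^sub>C a1)
          + ((q - inverse q) * w1 * w2) *\<^sub>C 1"
    unfolding q2 qi2 unfolding qi unfolding q1
    by (rule agree_onI; simp add: invs rep norm)
  \<comment> \<open>The exponents of \<open>K1\<close> and \<open>K2\<close> are opposite multiples
    of (1,1,1), so they commute with every monomial and their product is the monomial with exponent
    zero.\<close>
  have central: "a1 * a2 \<doteq>\<^bsub>D\<^esub> q^2 *\<^sub>C (c1 * b2)" "K1 * K2 \<doteq>\<^bsub>D\<^esub> 1"
    "(\<forall>K \<in> {K1, K2}. \<forall>T \<in> {a1, b1, c1, a2, b2, c2}. K * T \<doteq>\<^bsub>D\<^esub> T * K)"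
    unfolding q2
    by (auto intro!: agree_onI simp: invs K1_inv K2_inv rep norm)
  note edge = edge_mat_X edge_mat_Y edge_mat_Z
  \<comment> \<open>Every entry is a sum of products of four half-exponent monomials, one from each
    edge matrix. \<open>E_mult\<close> merges each product into a single monomial with a
    phase.\<close>
  have M1_form: "M1 \<doteq>\<doteq>\<^bsub>D\<^esub> monodromy_form q w1 a1 b1 c1"
    unfolding opmat_agree_on_def forall_2 M1 monodromy1_def R_mat_def L_mat_def F_mat_def
      monodromy_form_def qi unfolding q1
    by (intro conjI agree_onI opmat_mult_invariant edge(1,6,11) scalar_opmat_invariant csubspace;
        simp add: invs opmat_mult_app scalar_opmat_app R_num_nth edge rep norm)
  have M2_form: "M2 \<doteq>\<doteq>\<^bsub>D\<^esub> monodromy_form q w2 a2 b2 c2"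
    unfolding opmat_agree_on_def forall_2 M2 monodromy2_def R_mat_def L_mat_def F_mat_def
      monodromy_form_def qi unfolding q1
    by (intro conjI agree_onI opmat_mult_invariant edge(1,6,11) scalar_opmat_invariant csubspace;
        simp add: invs opmat_mult_app scalar_opmat_app R_num_nth edge rep norm)
  show ?thesis
    using M1_form M2_form sl2_1 sl2_2 q_commute mixed b1_c2 central by blast
qed

end
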